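(* Let $s,n$ be positive integers, $G$ a finite abelian group with $b\ge2$ elements and $P\subset G^{s\times n}$ a subgroup. Then $$W_{P^\perp}(x,y)=\frac1{|P|}\sum_{B\in P}\ \prod_{1\le i\le s,\ 1\le j\le n}\bigl(x^j+\eta(b_{i,j})\,y^j\bigr),$$ where $B=(b_{i,j})$, $\eta(b_{i,j})=b-1$ if $b_{i,j}=0$ and $\eta(b_{i,j})=-1$ if $b_{i,j}\ne0$.
   Context: $G^\vee=\mathrm{Hom}(G,T)$, with $T=\{z\in\mathbb{C}:|z|=1\}$, is the character group of $G$, written additively, and $h\bullet g:=h(g)$. The character group of $G^{s\times n}$ (the group of $s\times n$ matrices over $G$) is identified with $(G^\vee)^{s\times n}$ via $A\bullet B=\prod_{i,j}a_{i,j}\bullet b_{i,j}$. $P^\perp=\{A\in(G^\vee)^{s\times n}:A\bullet B=1\text{ for all }B\in P\}$. The Dick weight of $A=(a_{i,j})\in(G^\vee)^{s\times n}$ is $\mu(A)=\sum_{i,j}j\,\delta(a_{i,j})$ with $\delta(0)=0$ and $\delta(h)=1$ for $h\neq0$. The weight enumerator polynomial of $P^\perp$ is $W_{P^\perp}(x,y)=\sum_{A\in P^\perp}x^{M-\mu(A)}y^{\mu(A)}\in\mathbb{C}[x,y]$, where $M=n(n+1)s/2$. *)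

theory Defs
  imports
    Complex_Main
    "HOL-Algebra.Product_Groups"
    "HOL-Library.Poly_Mapping"
    "HOL-Library.Product_Plus"
begin

definition circle_group :: "complex monoid" where
  "circle_group = \<lparr>carrier = {z. cmod z = 1}, monoid.mult = (*), one = 1\<rparr>"

(* Characters are required to be extensional, so that two characters are equal as HOL functions
   iff they agree on the carrier of G.  The group law, written additively in the mathematics, is
   written multiplicatively here, as for all groups of HOL-Algebra. *)
definition char_group :: "('a, 'c) monoid_scheme \<Rightarrow> ('a \<Rightarrow> complex) monoid" where
  "char_group G =
     \<lparr>carrier = hom G circle_group \<inter> extensional (carrier G),
      monoid.mult = (\<lambda>h k. \<lambda>g\<in>carrier G. h g * k g),
      one = (\<lambda>g\<in>carrier G. 1)\<rparr>"

definition entries :: "nat \<Rightarrow> nat \<Rightarrow> (nat \<times> nat) set" where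
  "entries s n = {1..s} \<times> {1..n}"

(* A matrix is an extensional function of the pair (row, column). *)
definition matrix_group :: "nat \<Rightarrow> nat \<Rightarrow> ('a, 'c) monoid_scheme \<Rightarrow> (nat \<times> nat \<Rightarrow> 'a) monoid" where
  "matrix_group s n G = product_group (entries s n) (\<lambda>_. G)"

definition pairing ::
  "nat \<Rightarrow> nat \<Rightarrow> (nat \<times> nat \<Rightarrow> 'a \<Rightarrow> complex) \<Rightarrow> (nat \<times> nat \<Rightarrow> 'a) \<Rightarrow> complex" where
  "pairing s n A B = (\<Prod>(i, j)\<in>entries s n. A (i, j) (B (i, j)))"

definition dual_set ::
  "nat \<Rightarrow> nat \<Rightarrow> ('a, 'c) monoid_scheme \<Rightarrow> (nat \<times> nat \<Rightarrow> 'a) set \<Rightarrow> (nat \<times> nat \<Rightarrow> 'a \<Rightarrow> complex) set"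
  where
  "dual_set s n G P =
     {A \<in> carrier (matrix_group s n (char_group G)). \<forall>B\<in>P. pairing s n A B = 1}"

definition delta :: "('a, 'c) monoid_scheme \<Rightarrow> 'a \<Rightarrow> nat" where
  "delta H h = (if h = \<one>\<^bsub>H\<^esub> then 0 else 1)"

definition dick_weight ::
  "nat \<Rightarrow> nat \<Rightarrow> ('a, 'c) monoid_scheme \<Rightarrow> (nat \<times> nat \<Rightarrow> 'a \<Rightarrow> complex) \<Rightarrow> nat" where
  "dick_weight s n G A = (\<Sum>(i, j)\<in>entries s n. j * delta (char_group G) (A (i, j)))"

(* The polynomial ring C[x,y] as the monoid algebra of (nat * nat, +) over the complex numbers:
   the pair (k, l) is the exponent of the monomial x^k y^l, and multiplication in Poly_Mapping is
   convolution. *)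
type_synonym bipoly = "(nat \<times> nat) \<Rightarrow>\<^sub>0 complex"

definition Const :: "complex \<Rightarrow> bipoly" where
  "Const c = Poly_Mapping.single 0 c"

definition X :: bipoly where
  "X = Poly_Mapping.single (1, 0) 1"

definition Y :: bipoly where
  "Y = Poly_Mapping.single (0, 1) 1"

definition max_weight :: "nat \<Rightarrow> nat \<Rightarrow> nat" where
  "max_weight s n = n * (n + 1) * s div 2"

(* The truncated subtraction and the division in max_weight are exact: the Dick weight is at most
   max_weight s n, and n * (n + 1) is even. *)
definition weight_enumerator ::
  "nat \<Rightarrow> nat \<Rightarrow> ('a, 'c) monoid_scheme \<Rightarrow> (nat \<times> nat \<Rightarrow> 'a \<Rightarrow> complex) set \<Rightarrow> bipoly" where
  "weight_enumerator s n G Q =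
     (\<Sum>A\<in>Q. X ^ (max_weight s n - dick_weight s n G A) * Y ^ dick_weight s n G A)"

definition eta :: "('a, 'c) monoid_scheme \<Rightarrow> 'a \<Rightarrow> complex" where
  "eta G g = (if g = \<one>\<^bsub>G\<^esub> then of_nat (order G) - 1 else - 1)"

end

theory Submission
  imports Defs "HOL-Algebra.Multiplicative_Group"
begin

text \<open>
  This is a MacWilliams identity, and it rests on two orthogonality relations for characters.
  For a fixed matrix \<open>A\<close> of characters, \<open>B \<mapsto> A \<bullet> B\<close> is a homomorphism from \<open>P\<close> to the circle, so
  its sum over \<open>P\<close> is \<open>|P|\<close> or \<open>0\<close> according to whether \<open>A\<close> lies in the dual of \<open>P\<close>
  (\<open>sum_pairing_subgroup\<close>). Hence \<open>|P|\<close> times the weight enumerator is the sum, over all \<open>B\<close>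
  in \<open>P\<close> and all matrices \<open>A\<close> of characters, of \<open>A \<bullet> B\<close> times the monomial of \<open>A\<close>.
  For a fixed \<open>B\<close>, both the pairing and the monomial are products over the matrix entries, so
  the sum over all \<open>A\<close> factors into one sum over the character group per entry
  (\<open>sum_pairing_monomial\<close>). In the entry \<open>(i, j)\<close> the trivial character contributes \<open>x\<^sup>j\<close>, and
  the others contribute \<open>y\<^sup>j\<close> times the sum of their values at \<open>b\<^sub>i\<^sub>j\<close>. By the second
  orthogonality relation (\<open>sum_characters_at\<close>) that sum is \<open>\<eta>(b\<^sub>i\<^sub>j)\<close>.

  The second relation needs the nontrivial fact that the characters of a finite abelian group
  separate its points. It is obtained by extending characters from a subgroup to the whole
  group, one generator at a time (\<open>extend_circle_hom_by_element\<close>): if \<open>m\<close> is the order of \<open>a\<close>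
  modulo the subgroup, the value at \<open>a\<close> may be any \<open>m\<close>-th root of the value prescribed at
  \<open>a\<^sup>m\<close>.
\<close>

section \<open>Homomorphisms into the circle\<close>

lemma circle_hom_iff:
  "f \<in> hom K circle_group \<longleftrightarrow>
     (\<forall>x\<in>carrier K. cmod (f x) = 1) \<and>
     (\<forall>x\<in>carrier K. \<forall>y\<in>carrier K. f (x \<otimes>\<^bsub>K\<^esub> y) = f x * f y)"
  by (auto simp: hom_def circle_group_def)

lemma group_circle_group: "group circle_group"
proof (rule groupI)
  fix z assume "z \<in> carrier circle_group"
  then show "\<exists>w\<in>carrier circle_group. w \<otimes>\<^bsub>circle_group\<^esub> z = \<one>\<^bsub>circle_group\<^esub>"
    by (intro bexI[of _ "inverse z"]) (auto simp: circle_group_def norm_inverse intro!: left_inverse)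
qed (auto simp: circle_group_def norm_mult)

lemma circle_group_int_pow:
  assumes "z \<in> carrier circle_group"
  shows "z [^]\<^bsub>circle_group\<^esub> (k::int) = z powi k"
proof -
  have nat_pow: "z [^]\<^bsub>circle_group\<^esub> (m::nat) = z ^ m" for m
    by (induction m) (simp_all add: circle_group_def nat_pow_def)
  have "inv\<^bsub>circle_group\<^esub> w = inverse w" if "w \<in> carrier circle_group" for w
    by (rule group.inv_equality[OF group_circle_group])
      (use that in \<open>auto simp: circle_group_def norm_inverse intro!: left_inverse\<close>)
  moreover have "z ^ m \<in> carrier circle_group" for m
    using assms by (auto simp: circle_group_def norm_power)
  ultimately show ?thesis
    by (simp add: int_pow_def2 nat_pow power_int_def power_inverse)
qed

lemma circle_hom_one:
  assumes "group K" "f \<in> hom K circle_group"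
  shows "f \<one>\<^bsub>K\<^esub> = 1"
  using hom_one[OF assms(2,1) group_circle_group] by (simp add: circle_group_def)

lemma circle_hom_int_pow:
  assumes "group K" "f \<in> hom K circle_group" "x \<in> carrier K"
  shows "f (x [^]\<^bsub>K\<^esub> (k::int)) = f x powi k"
  using hom_int_pow[OF assms(2,3,1) group_circle_group] circle_group_int_pow[of "f x"]
    hom_carrier[OF assms(2)] assms(3) by auto

text \<open>
  If \<open>f c \<noteq> 1\<close>, translating the summation variable by \<open>c\<close> multiplies the sum by \<open>f c\<close>, so the
  sum vanishes. This gives both orthogonality relations: it applies to \<open>P\<close>, to \<open>G\<close>, and to
  the character group of \<open>G\<close> with evaluation at a point as the homomorphism.
\<close>

lemma sum_circle_hom:
  assumes "group K" "f \<in> hom K circle_group"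
  shows "(\<Sum>x\<in>carrier K. f x) =
    (if \<forall>x\<in>carrier K. f x = 1 then of_nat (card (carrier K)) else 0)"
proof (cases "\<forall>x\<in>carrier K. f x = 1")
  case True
  then show ?thesis by simp
next
  case False
  interpret group K by fact
  obtain c where c: "c \<in> carrier K" "f c \<noteq> 1"
    using False by blast
  have "(\<Sum>x\<in>carrier K. f x) = (\<Sum>x\<in>(\<lambda>x. c \<otimes>\<^bsub>K\<^esub> x) ` carrier K. f x)"
    using surj_const_mult[OF c(1)] by simp
  also have "\<dots> = (\<Sum>x\<in>carrier K. f c * f x)"
    using inj_on_cmult[OF c(1)] c(1) assms(2)
    by (simp add: sum.reindex circle_hom_iff)
  also have "\<dots> = f c * (\<Sum>x\<in>carrier K. f x)"
    by (simp only: sum_distrib_left)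
  finally have "(\<Sum>x\<in>carrier K. f x) = f c * (\<Sum>x\<in>carrier K. f x)" .
  then have "(\<Sum>x\<in>carrier K. f x) = 0"
    using c(2) by (metis mult_cancel_right1)
  then show ?thesis using False by (simp only: if_False)
qed

section \<open>Characters separate points\<close>

text \<open>
  The exponents \<open>k\<close> with \<open>a\<^sup>k \<in> H\<close> form a subgroup of the integers, nonzero because \<open>G\<close> is
  finite; \<open>m\<close> is its positive generator, the order of \<open>a\<close> modulo \<open>H\<close>.
\<close>

lemma (in group) relative_order:
  assumes "finite (carrier G)" "subgroup H G" "a \<in> carrier G"
  obtains m :: nat where "m > 0" "\<And>k::int. a [^] k \<in> H \<longleftrightarrow> int m dvd k"
proof -
  define m where "m = (LEAST m::nat. m > 0 \<and> a [^] m \<in> H)"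
  have "order G > 0 \<and> a [^] order G \<in> H"
    using assms order_gt_0_iff_finite pow_order_eq_1 subgroup.one_closed by auto
  then have m: "m > 0" "a [^] m \<in> H"
    using LeastI[of "\<lambda>m::nat. m > 0 \<and> a [^] m \<in> H"] by (auto simp: m_def)
  have mult: "a [^] (int m * q) \<in> H" for q :: int
  proof -
    have "a [^] (int m * q) = (a [^] m) [^] q"
      using assms(3) int_pow_pow[of a "int m" q] by (simp add: int_pow_int mult.commute)
    then show ?thesis
      using subgroup_int_pow_closed[OF assms(2) m(2)] by simp
  qed
  have "int m dvd k" if "a [^] k \<in> H" for k :: int
  proof -
    define r where "r = nat (k mod int m)"
    have r: "int r = k mod int m" "r < m"
      using m(1) by (auto simp: r_def nat_less_iff)
    have "k = int r + int m * (k div int m)"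
      by (simp add: r)
    then have "a [^] (int r) = a [^] k \<otimes> inv (a [^] (int m * (k div int m)))"
      using int_pow_diff[OF assms(3), of k "int m * (k div int m)"]
      by (metis add_diff_cancel_right')
    then have "a [^] r \<in> H"
      using that mult[of "k div int m"] assms(2)
      by (simp add: int_pow_int subgroup.m_closed subgroup.m_inv_closed)
    then have "\<not> r > 0"
      using not_less_Least[of r "\<lambda>m::nat. m > 0 \<and> a [^] m \<in> H"] r(2) by (auto simp: m_def)
    then show ?thesis using r(1) by auto
  qed
  moreover have "a [^] k \<in> H" if "int m dvd k" for k
    using that mult by (auto elim: dvdE)
  ultimately show ?thesis using that m(1) by blast
qed

text \<open>
  The extension lives on \<open>K = H \<langle>a\<rangle>\<close> and sends \<open>h a\<^sup>k\<close> to \<open>\<chi>(h) w\<^sup>k\<close>. This is consistent because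
  two representations of the same element differ by a power of \<open>a\<close> that lies in \<open>H\<close>, hence by a
  power of \<open>a\<^sup>m\<close>, where \<open>\<chi>\<close> already takes the value \<open>w\<^sup>m\<close>. Leaving the choice of the root \<open>w\<close>
  free is what makes it possible to separate points.
\<close>

lemma (in comm_group) extend_circle_hom_by_element:
  assumes H: "subgroup H G" and a: "a \<in> carrier G"
    and \<chi>: "\<chi> \<in> hom (G\<lparr>carrier := H\<rparr>) circle_group"
    and m: "m > 0" "\<And>k::int. a [^] k \<in> H \<longleftrightarrow> int m dvd k"
    and w: "w ^ m = \<chi> (a [^] m)"
  obtains K \<psi> where "subgroup K G" "H \<subseteq> K" "a \<in> K"
    "\<psi> \<in> hom (G\<lparr>carrier := K\<rparr>) circle_group" "\<And>x. x \<in> H \<Longrightarrow> \<psi> x = \<chi> x" "\<psi> a = w"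
proof -
  interpret H: subgroup H G by fact
  have GH: "group (G\<lparr>carrier := H\<rparr>)"
    using H by (rule subgroup_imp_group)
  have norm: "cmod (\<chi> x) = 1" if "x \<in> H" for x
    using \<chi> that by (auto simp: circle_hom_iff)
  have mult: "\<chi> (x \<otimes> y) = \<chi> x * \<chi> y" if "x \<in> H" "y \<in> H" for x y
    using \<chi> that by (auto simp: circle_hom_iff)
  have am: "a [^] m \<in> H"
    using m(2)[of "int m"] by (simp add: int_pow_int)
  have w1: "cmod w = 1"
  proof -
    have "cmod w ^ m = 1"
      using norm[OF am] w by (simp flip: norm_power)
    then show ?thesis
      using m(1) power_eq_imp_eq_base[of "cmod w" m 1] by simp
  qed
  then have w0: "w \<noteq> 0" by auto
  have \<chi>_pow: "\<chi> (a [^] k) = w powi k" if k: "a [^] k \<in> H" for k :: int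
  proof -
    obtain q where q: "k = int m * q"
      using m(2)[of k] k by (auto elim: dvdE)
    have "a [^] k = (a [^] m) [^] q"
      using a int_pow_pow[of a "int m" q] by (simp add: q int_pow_int mult.commute)
    also have "\<chi> \<dots> = \<chi> (a [^] m) powi q"
      unfolding int_pow_consistent[OF H am] by (rule circle_hom_int_pow[OF GH \<chi>]) (simp add: am)
    also have "\<dots> = w powi k"
      by (simp add: w[symmetric] q power_int_mult)
    finally show ?thesis .
  qed
  have well_defined: "\<chi> h * w powi k = \<chi> h' * w powi l"
    if h: "h \<in> H" "h' \<in> H" and eq: "h \<otimes> a [^] k = h' \<otimes> a [^] l" for h h' and k l :: int
  proof -
    have car: "h \<in> carrier G" "h' \<in> carrier G" "a [^] k \<in> carrier G" "a [^] l \<in> carrier G"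
      using h a H.subset by auto
    have "a [^] (k - l) = a [^] k \<otimes> inv (a [^] l)"
      using a by (rule int_pow_diff)
    also have "a [^] k = inv h \<otimes> (h' \<otimes> a [^] l)"
      using eq car by (metis inv_solve_left m_closed)
    finally have diff: "a [^] (k - l) = inv h \<otimes> h'"
      using car by (simp add: m_assoc)
    then have *: "h' = h \<otimes> a [^] (k - l)"
      using car by (simp flip: m_assoc)
    have "a [^] (k - l) \<in> H" using h diff by simp
    then have "\<chi> h' = \<chi> h * w powi (k - l)"
      using * mult[OF h(1), of "a [^] (k - l)"] \<chi>_pow[of "k - l"] by metis
    then show ?thesis using w0 by (simp add: power_int_diff)
  qed
  define K where "K = {x. \<exists>h\<in>H. \<exists>k::int. x = h \<otimes> a [^] k}"
  have K_I: "h \<otimes> a [^] k \<in> K" if "h \<in> H" for h and k :: int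
    using that by (auto simp: K_def)
  have K_E: "\<exists>h k. h \<in> H \<and> x = h \<otimes> a [^] (k::int)" if "x \<in> K" for x
    using that by (auto simp: K_def)
  \<comment> \<open>The choice runs over all representations \<open>h a\<^sup>k\<close> of \<open>x\<close>; they all give the same value.\<close>
  define \<psi> where "\<psi> x = (SOME v. \<exists>h\<in>H. \<exists>k::int. x = h \<otimes> a [^] k \<and> v = \<chi> h * w powi k)" for x
  have \<psi>: "\<psi> (h \<otimes> a [^] k) = \<chi> h * w powi k" if "h \<in> H" for h and k :: int
    unfolding \<psi>_def
  proof (rule some_equality)
    show "\<exists>h'\<in>H. \<exists>l. h \<otimes> a [^] k = h' \<otimes> a [^] l \<and> \<chi> h * w powi k = \<chi> h' * w powi l"
      using that by blast
  next
    fix v assume "\<exists>h'\<in>H. \<exists>l::int. h \<otimes> a [^] k = h' \<otimes> a [^] l \<and> v = \<chi> h' * w powi l"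
    then obtain h' and l :: int where "h' \<in> H" "h \<otimes> a [^] k = h' \<otimes> a [^] l" "v = \<chi> h' * w powi l"
      by blast
    then show "v = \<chi> h * w powi k"
      using well_defined[OF that, of h' k l] by (simp only:)
  qed
  have prod: "(h \<otimes> a [^] k) \<otimes> (h' \<otimes> a [^] l) = (h \<otimes> h') \<otimes> a [^] (k + l)"
    if "h \<in> H" "h' \<in> H" for h h' and k l :: int
    using that a H.subset by (simp add: int_pow_mult m_ac subset_iff)
  have "subgroup K G"
  proof (rule subgroupI)
    show "K \<subseteq> carrier G" using a by (auto simp: K_def)
    show "K \<noteq> {}" using K_I[OF H.one_closed] by blast
  next
    fix x assume "x \<in> K"
    then obtain h and k :: int where x: "h \<in> H" "x = h \<otimes> a [^] k"
      using K_E by blast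
    then have "inv x = inv h \<otimes> a [^] (- k)"
      using a by (simp add: inv_mult int_pow_neg)
    then show "inv x \<in> K" using x(1) K_I by simp
  next
    fix x y assume "x \<in> K" "y \<in> K"
    then obtain h h' and k l :: int
      where "h \<in> H" "x = h \<otimes> a [^] k" "h' \<in> H" "y = h' \<otimes> a [^] l"
      using K_E by metis
    then show "x \<otimes> y \<in> K" using prod[of h h' k l] K_I by simp
  qed
  moreover have sub: "x \<otimes> a [^] (0::int) = x" if "x \<in> H" for x
    using that by simp
  moreover have "H \<subseteq> K"
    using K_I[where k = 0] by (auto simp: sub)
  moreover have a_eq: "\<one> \<otimes> a [^] (1::int) = a"
    using a by simp
  moreover have "a \<in> K"
    using K_I[OF H.one_closed, of 1] by (simp only: a_eq)
  moreover have "\<psi> \<in> hom (G\<lparr>carrier := K\<rparr>) circle_group"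
    unfolding circle_hom_iff
  proof (intro conjI ballI)
    fix x assume "x \<in> carrier (G\<lparr>carrier := K\<rparr>)"
    then obtain h and k :: int where "h \<in> H" "x = h \<otimes> a [^] k"
      using K_E[of x] by auto
    then show "cmod (\<psi> x) = 1"
      by (simp add: \<psi> norm norm_mult norm_power_int w1)
  next
    fix x y assume "x \<in> carrier (G\<lparr>carrier := K\<rparr>)" "y \<in> carrier (G\<lparr>carrier := K\<rparr>)"
    then obtain h h' and k l :: int
      where xy: "h \<in> H" "x = h \<otimes> a [^] k" "h' \<in> H" "y = h' \<otimes> a [^] l"
      using K_E[of x] K_E[of y] by auto
    have "\<psi> (x \<otimes> y) = \<chi> (h \<otimes> h') * w powi (k + l)"
      using xy by (simp add: prod \<psi>)
    also have "\<dots> = \<psi> x * \<psi> y"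
      using xy w0 by (simp add: \<psi> mult power_int_add)
    finally show "\<psi> (x \<otimes>\<^bsub>G\<lparr>carrier := K\<rparr>\<^esub> y) = \<psi> x * \<psi> y"
      by simp
  qed
  moreover have "\<psi> x = \<chi> x" if "x \<in> H" for x
    using \<psi>[OF that, of 0] by (simp only: sub[OF that]) simp
  moreover have "\<psi> a = w"
    using \<psi>[OF H.one_closed, of 1] circle_hom_one[OF GH \<chi>] by (simp only: a_eq) simp
  ultimately show ?thesis using that by blast
qed

lemma complex_root_exists:
  fixes z :: complex
  assumes "m > 0"
  obtains w where "w ^ m = z"
proof -
  have "(rcis (root m (cmod z)) (Arg z / of_nat m)) ^ m = z"
    using assms by (simp add: DeMoivre2 rcis_cmod_Arg)
  then show ?thesis using that by blast
qed

text \<open>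
  Induction on the size of the complement of the subgroup. An arbitrary complex root serves as
  the value at the new element, since a root of a number of modulus 1 has modulus 1.
\<close>

lemma (in comm_group) extend_circle_hom:
  assumes fin: "finite (carrier G)"
    and "subgroup H G" "\<chi> \<in> hom (G\<lparr>carrier := H\<rparr>) circle_group"
  obtains \<psi> where "\<psi> \<in> hom G circle_group" "\<And>x. x \<in> H \<Longrightarrow> \<psi> x = \<chi> x"
proof -
  have "\<exists>\<psi> \<in> hom G circle_group. \<forall>x\<in>H. \<psi> x = \<chi> x"
    using assms(2,3)
  proof (induction "card (carrier G - H)" arbitrary: H \<chi> rule: less_induct)
    case less
    show ?case
    proof (cases "H = carrier G")
      case True
      then show ?thesis using less.prems by auto
    next
      case False
      then obtain a where a: "a \<in> carrier G" "a \<notin> H"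
        using subgroup.subset[OF less.prems(1)] by blast
      obtain m where m: "m > 0" "\<And>k::int. a [^] k \<in> H \<longleftrightarrow> int m dvd k"
        using relative_order[OF fin less.prems(1) a(1)] by blast
      obtain w where w: "w ^ m = \<chi> (a [^] m)"
        using complex_root_exists[OF m(1)] by blast
      obtain K \<psi> where K: "subgroup K G" "H \<subseteq> K" "a \<in> K"
        "\<psi> \<in> hom (G\<lparr>carrier := K\<rparr>) circle_group" "\<And>x. x \<in> H \<Longrightarrow> \<psi> x = \<chi> x"
        using extend_circle_hom_by_element[OF less.prems(1) a(1) less.prems(2) m w] by metis
      have "card (carrier G - K) < card (carrier G - H)"
        using fin K(2,3) a by (intro psubset_card_mono) auto
      from less.hyps[OF this K(1,4)] obtain \<psi>' where
        "\<psi>' \<in> hom G circle_group" "\<forall>x\<in>K. \<psi>' x = \<psi> x"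
        by blast
      then show ?thesis
        using K(2,5) by (intro bexI[of _ \<psi>']) auto
    qed
  qed
  then show ?thesis using that by blast
qed

text \<open>
  Over the trivial subgroup, the order \<open>m\<close> of \<open>g\<close> is at least 2, so the value at \<open>g\<close> can be
  chosen as an \<open>m\<close>-th root of unity other than 1; the resulting character of \<open>\<langle>g\<rangle>\<close> then extends
  to the whole group.
\<close>

lemma (in comm_group) circle_homs_separate_points:
  assumes fin: "finite (carrier G)" and g: "g \<in> carrier G" "g \<noteq> \<one>"
  obtains \<psi> where "\<psi> \<in> hom G circle_group" "\<psi> g \<noteq> 1"
proof -
  have triv: "subgroup {\<one>} G" by (rule triv_subgroup)
  obtain m where m: "m > 0" "\<And>k::int. g [^] k \<in> {\<one>} \<longleftrightarrow> int m dvd k"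
    using relative_order[OF fin triv g(1)] by blast
  have "m \<noteq> 1"
    using m(2)[of 1] g by auto
  obtain w :: complex where w: "w ^ m = 1" "w \<noteq> 1"
  proof -
    have "card {z::complex. z ^ m = 1} = m"
      using m(1) by (rule card_roots_unity_eq)
    then have "\<not> {z::complex. z ^ m = 1} \<subseteq> {1}"
      using m(1) \<open>m \<noteq> 1\<close> card_mono[of "{1::complex}" "{z. z ^ m = 1}"] by auto
    then show ?thesis using that by blast
  qed
  have trivial: "(\<lambda>_. 1) \<in> hom (G\<lparr>carrier := {\<one>}\<rparr>) circle_group"
    by (simp add: circle_hom_iff)
  obtain K \<chi> where K: "subgroup K G" "g \<in> K" "\<chi> \<in> hom (G\<lparr>carrier := K\<rparr>) circle_group" "\<chi> g = w"
    using extend_circle_hom_by_element[OF triv g(1) trivial m w(1)] by metis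
  obtain \<psi> where "\<psi> \<in> hom G circle_group" "\<And>x. x \<in> K \<Longrightarrow> \<psi> x = \<chi> x"
    using extend_circle_hom[OF fin K(1,3)] by blast
  then show ?thesis using that K w(2) by metis
qed

section \<open>The character group of a finite abelian group\<close>

lemma group_char_group:
  assumes "group G"
  shows "group (char_group G)"
proof -
  interpret group G by fact
  show ?thesis
  proof (rule groupI)
    fix h assume h: "h \<in> carrier (char_group G)"
    then have "(\<lambda>g\<in>carrier G. inverse (h g)) \<in> carrier (char_group G)"
      by (auto simp: char_group_def circle_hom_iff norm_inverse)
    moreover have "(\<lambda>g\<in>carrier G. inverse (h g)) \<otimes>\<^bsub>char_group G\<^esub> h = \<one>\<^bsub>char_group G\<^esub>"
    proof -
      have "inverse (h x) * h x = 1" if "x \<in> carrier G" for x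
        using h that by (intro left_inverse) (auto simp: char_group_def circle_hom_iff)
      then show ?thesis by (auto simp: char_group_def)
    qed
    ultimately show "\<exists>k\<in>carrier (char_group G). k \<otimes>\<^bsub>char_group G\<^esub> h = \<one>\<^bsub>char_group G\<^esub>"
      by blast
  qed (auto simp: char_group_def circle_hom_iff norm_mult extensional_def fun_eq_iff)
qed

text \<open>
  The values of a character are roots of unity of order dividing that of \<open>G\<close>, which leaves
  finitely many functions.
\<close>

lemma finite_char_group:
  assumes "group G" "finite (carrier G)"
  shows "finite (carrier (char_group G))"
proof (rule finite_subset)
  interpret group G by fact
  have pos: "order G > 0" using assms(2) order_gt_0_iff_finite by simp
  show "carrier (char_group G) \<subseteq> carrier G \<rightarrow>\<^sub>E {z. z ^ order G = 1}"
  proof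
    fix h assume "h \<in> carrier (char_group G)"
    then have h: "h \<in> hom G circle_group" "h \<in> extensional (carrier G)"
      by (auto simp: char_group_def)
    have "h x ^ order G = 1" if "x \<in> carrier G" for x
      using circle_hom_int_pow[OF assms(1) h(1) that, of "int (order G)"]
        circle_hom_one[OF assms(1) h(1)] pow_order_eq_1[OF that]
      by (simp add: int_pow_int)
    then show "h \<in> carrier G \<rightarrow>\<^sub>E {z. z ^ order G = 1}"
      using h(2) by (auto simp: PiE_iff)
  qed
  show "finite (carrier G \<rightarrow>\<^sub>E {z::complex. z ^ order G = 1})"
    using assms(2) pos by (intro finite_PiE finite_roots_unity) auto
qed

text \<open>
  Evaluation at \<open>g\<close> is a homomorphism on the character group, trivial only for the neutral
  element because characters separate points. So the sum is 0 elsewhere, and at the neutral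
  element it is the number of characters. That this number is the order of \<open>G\<close> follows by
  summing all values \<open>h(x)\<close> in both orders: by columns only the neutral element contributes, by
  rows only the trivial character.
\<close>

lemma sum_characters_at:
  assumes "comm_group G" "finite (carrier G)" "g \<in> carrier G"
  shows "(\<Sum>h\<in>carrier (char_group G). h g) = (if g = \<one>\<^bsub>G\<^esub> then of_nat (order G) else 0)"
proof -
  interpret comm_group G by fact
  have trivial: "(\<forall>h\<in>carrier (char_group G). h x = 1) \<longleftrightarrow> x = \<one>\<^bsub>G\<^esub>" if x: "x \<in> carrier G" for x
  proof
    assume *: "\<forall>h\<in>carrier (char_group G). h x = 1"
    show "x = \<one>\<^bsub>G\<^esub>"
    proof (rule ccontr)
      assume "x \<noteq> \<one>\<^bsub>G\<^esub>"
      then obtain \<psi> where "\<psi> \<in> hom G circle_group" "\<psi> x \<noteq> 1"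
        using circle_homs_separate_points[OF assms(2) x] by blast
      moreover from this have "restrict \<psi> (carrier G) \<in> carrier (char_group G)"
        by (auto simp: char_group_def circle_hom_iff)
      ultimately show False using * x by force
    qed
  qed (auto simp: char_group_def intro: circle_hom_one is_group)
  \<comment> \<open>Sums over the characters at a fixed point, with the number of characters still unknown.\<close>
  have column: "(\<Sum>h\<in>carrier (char_group G). h x) =
      (if x = \<one>\<^bsub>G\<^esub> then of_nat (card (carrier (char_group G))) else 0)" if x: "x \<in> carrier G" for x
  proof -
    have "(\<lambda>h. h x) \<in> hom (char_group G) circle_group"
      using x by (auto simp: char_group_def circle_hom_iff)
    from sum_circle_hom[OF group_char_group[OF is_group] this] show ?thesis
      using trivial[OF x] by simp
  qed
  have row: "(\<Sum>x\<in>carrier G. h x) = (if h = \<one>\<^bsub>char_group G\<^esub> then of_nat (order G) else 0)"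
    if "h \<in> carrier (char_group G)" for h
  proof -
    have "(\<forall>x\<in>carrier G. h x = 1) \<longleftrightarrow> h = \<one>\<^bsub>char_group G\<^esub>"
      using that by (auto simp: char_group_def extensional_def fun_eq_iff)
    then show ?thesis
      using sum_circle_hom[OF is_group, of h] that by (simp add: char_group_def order_def)
  qed
  have "of_nat (card (carrier (char_group G))) = (\<Sum>x\<in>carrier G. \<Sum>h\<in>carrier (char_group G). h x)"
    using assms(2) by (simp add: column)
  also have "\<dots> = (\<Sum>h\<in>carrier (char_group G). \<Sum>x\<in>carrier G. h x)"
    by (rule sum.swap)
  also have "\<dots> = (of_nat (order G) :: complex)"
    using finite_char_group[OF is_group assms(2)]
      monoid.one_closed[OF group.is_monoid[OF group_char_group[OF is_group]]]
    by (simp add: row)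
  finally show ?thesis using column[OF assms(3)] by simp
qed

section \<open>Duality for matrices\<close>

lemma finite_entries: "finite (entries s n)"
  by (simp add: entries_def)

lemma pairing_hom:
  assumes "A \<in> carrier (matrix_group s n (char_group G))"
  shows "pairing s n A \<in> hom (matrix_group s n G) circle_group"
proof -
  have "A e \<in> hom G circle_group" if "e \<in> entries s n" for e
    using assms that by (auto simp: matrix_group_def char_group_def PiE_iff)
  then show ?thesis
    unfolding circle_hom_iff
    by (auto simp: pairing_def matrix_group_def PiE_iff split_beta
        simp flip: prod.distrib prod_norm intro!: prod.cong prod.neutral)
qed

lemma sum_pairing_subgroup:
  assumes "group G" "subgroup P (matrix_group s n G)"
    and "A \<in> carrier (matrix_group s n (char_group G))"
  shows "(\<Sum>B\<in>P. pairing s n A B) = (if A \<in> dual_set s n G P then of_nat (card P) else 0)"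
proof -
  have grp: "group (matrix_group s n G)"
    using assms(1) by (simp add: matrix_group_def)
  have "pairing s n A \<in> hom (matrix_group s n G\<lparr>carrier := P\<rparr>) circle_group"
    using pairing_hom[OF assms(3)] subgroup.subset[OF assms(2)]
    by (auto simp: circle_hom_iff)
  from sum_circle_hom[OF group.subgroup_imp_group[OF grp assms(2)] this] show ?thesis
    using assms(3) by (simp add: dual_set_def)
qed

section \<open>The polynomial identity\<close>

lemma Const_mult: "Const (c * d) = Const c * Const d"
  by (simp add: Const_def mult_single)

lemma Const_one: "Const 1 = 1"
  by (simp add: Const_def)

lemma Const_add: "Const (c + d) = Const c + Const d"
  by (simp add: Const_def single_add)

lemma Const_zero: "Const 0 = 0"
  by (simp add: Const_def)

lemma Const_sum: "Const (\<Sum>x\<in>S. f x) = (\<Sum>x\<in>S. Const (f x))"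
  by (induction S rule: infinite_finite_induct) (simp_all add: Const_zero Const_add)

lemma Const_prod: "Const (\<Prod>x\<in>S. f x) = (\<Prod>x\<in>S. Const (f x))"
  by (induction S rule: infinite_finite_induct) (simp_all add: Const_one Const_mult)

lemma sum_column_indices: "(\<Sum>(i, j)\<in>entries s n. j) = max_weight s n"
proof -
  have "(\<Sum>(i, j)\<in>entries s n. j) = s * (\<Sum>j=1..n. j)"
    by (simp add: entries_def flip: sum.cartesian_product)
  also have "\<dots> = s * (n * (n + 1) div 2)"
    using gauss_sum_from_Suc_0[of n, where 'a = nat] by simp
  also have "\<dots> = max_weight s n"
    unfolding max_weight_def by (metis div_mult_swap dvd_triv_left even_mult_iff even_plus_one_iff mult.commute)
  finally show ?thesis .
qed

text \<open>
  Each entry in column \<open>j\<close> contributes degree \<open>j\<close> to the monomial, as a power of \<open>x\<close> or of \<open>y\<close>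
  according to whether the entry is trivial; together the entries account for the total degree
  \<open>M\<close>. This product form is what lets the sum over all matrices factor.
\<close>

lemma weight_monomial:
  "X ^ (max_weight s n - dick_weight s n G A) * Y ^ dick_weight s n G A =
     (\<Prod>e\<in>entries s n. X ^ (snd e * (1 - delta (char_group G) (A e))) *
                       Y ^ (snd e * delta (char_group G) (A e)))"
proof -
  let ?d = "\<lambda>e. delta (char_group G) (A e)"
  have "(\<Sum>e\<in>entries s n. snd e * (1 - ?d e)) + dick_weight s n G A = max_weight s n"
    unfolding sum_column_indices[symmetric] dick_weight_def
    by (auto simp: delta_def split_beta simp flip: sum.distrib intro!: sum.cong)
  then have "max_weight s n - dick_weight s n G A = (\<Sum>e\<in>entries s n. snd e * (1 - ?d e))"
    by simp
  then show ?thesis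
    by (simp add: prod.distrib power_sum dick_weight_def split_beta)
qed

text \<open>
  The factor of the identity belonging to one matrix entry. The trivial character is split off
  as the term \<open>x\<^sup>j\<close>; the values of the others sum to \<open>|G| - 1\<close> or \<open>-1\<close>, which is \<open>\<eta>\<close>.
\<close>

lemma sum_characters_monomial:
  assumes "comm_group G" "finite (carrier G)" "g \<in> carrier G"
  shows "(\<Sum>h\<in>carrier (char_group G). Const (h g) *
            (X ^ (j * (1 - delta (char_group G) h)) * Y ^ (j * delta (char_group G) h))) =
         X ^ j + Const (eta G g) * Y ^ j"
proof -
  let ?C = "carrier (char_group G)" and ?e = "\<one>\<^bsub>char_group G\<^esub>"
  interpret G: comm_group G by fact
  interpret C: group "char_group G" by (rule group_char_group[OF G.is_group])
  have fin: "finite ?C" by (rule finite_char_group[OF G.is_group assms(2)])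
  have one: "?e g = 1" using assms(3) by (simp add: char_group_def)
  have "(\<Sum>h\<in>?C - {?e}. h g) = eta G g"
    using sum_characters_at[OF assms] fin one by (simp add: sum_diff1 eta_def)
  moreover have "(\<Sum>h\<in>?C - {?e}. Const (h g) *
      (X ^ (j * (1 - delta (char_group G) h)) * Y ^ (j * delta (char_group G) h))) =
      Const (\<Sum>h\<in>?C - {?e}. h g) * Y ^ j"
    by (simp add: delta_def Const_sum sum_distrib_right)
  ultimately show ?thesis
    using fin by (subst sum.remove[of _ ?e]) (simp_all add: one Const_one delta_def)
qed

text \<open>
  A matrix of characters is an independent choice of one character per entry, so the sum over
  all matrices of a product over the entries is the product of the sums over the characters.
\<close>

lemma sum_pairing_monomial:
  assumes "comm_group G" "finite (carrier G)" "B \<in> carrier (matrix_group s n G)"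
  shows "(\<Sum>A\<in>carrier (matrix_group s n (char_group G)). Const (pairing s n A B) *
            (X ^ (max_weight s n - dick_weight s n G A) * Y ^ dick_weight s n G A)) =
         (\<Prod>(i, j)\<in>entries s n. X ^ j + Const (eta G (B (i, j))) * Y ^ j)"
proof -
  let ?C = "carrier (char_group G)"
  let ?t = "\<lambda>e h. Const (h (B e)) *
    (X ^ (snd e * (1 - delta (char_group G) h)) * Y ^ (snd e * delta (char_group G) h))"
  have fin: "finite ?C"
    using assms(1,2) by (intro finite_char_group comm_group.axioms(2))
  have B: "B e \<in> carrier G" if "e \<in> entries s n" for e
    using assms(3) that by (auto simp: matrix_group_def)
  have "(\<Sum>A\<in>carrier (matrix_group s n (char_group G)). Const (pairing s n A B) *
          (X ^ (max_weight s n - dick_weight s n G A) * Y ^ dick_weight s n G A)) =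
        (\<Sum>A\<in>PiE (entries s n) (\<lambda>_. ?C). \<Prod>e\<in>entries s n. ?t e (A e))"
    by (simp add: matrix_group_def weight_monomial pairing_def split_beta Const_prod
        flip: prod.distrib)
  also have "\<dots> = (\<Prod>e\<in>entries s n. \<Sum>h\<in>?C. ?t e h)"
    by (rule prod_sum_PiE[symmetric]) (simp_all add: finite_entries fin)
  also have "\<dots> = (\<Prod>e\<in>entries s n. X ^ snd e + Const (eta G (B e)) * Y ^ snd e)"
    by (intro prod.cong refl sum_characters_monomial assms B)
  finally show ?thesis by (simp add: split_beta)
qed

theorem theorem4p3:
  fixes G :: "('a, 'c) monoid_scheme"
    and s n :: nat
    and P :: "(nat \<times> nat \<Rightarrow> 'a) set"
  assumes "s \<ge> 1" and "n \<ge> 1"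
    and "comm_group G" and "finite (carrier G)" and "order G \<ge> 2"
    and "subgroup P (matrix_group s n G)"
  shows "weight_enumerator s n G (dual_set s n G P) =
           Const (1 / of_nat (card P)) *
           (\<Sum>B\<in>P. \<Prod>(i, j)\<in>entries s n. X ^ j + Const (eta G (B (i, j))) * Y ^ j)"
proof -
  interpret G: comm_group G by fact
  let ?M = "carrier (matrix_group s n (char_group G))"
  let ?m = "\<lambda>A. X ^ (max_weight s n - dick_weight s n G A) * Y ^ dick_weight s n G A"
  have P_sub: "P \<subseteq> carrier (matrix_group s n G)"
    using assms(6) by (rule subgroup.subset)
  have "finite (carrier (matrix_group s n G))"
    using assms(4) by (auto simp: matrix_group_def finite_entries intro: finite_PiE)
  then have "card P > 0"
    using P_sub subgroup.one_closed[OF assms(6)] finite_subset by (auto simp: card_gt_0_iff)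
  then have cancel: "Const (1 / of_nat (card P)) * Const (of_nat (card P)) = 1"
    by (simp add: Const_one flip: Const_mult)
  have finM: "finite ?M"
    using finite_char_group[OF G.is_group assms(4)]
    by (auto simp: matrix_group_def finite_entries intro: finite_PiE)
  have "(\<Sum>B\<in>P. \<Prod>(i, j)\<in>entries s n. X ^ j + Const (eta G (B (i, j))) * Y ^ j) =
        (\<Sum>B\<in>P. \<Sum>A\<in>?M. Const (pairing s n A B) * ?m A)"
    using P_sub by (intro sum.cong refl sum_pairing_monomial[symmetric] assms) auto
  also have "\<dots> = (\<Sum>A\<in>?M. Const (\<Sum>B\<in>P. pairing s n A B) * ?m A)"
    by (subst sum.swap) (simp add: Const_sum sum_distrib_right)
  also have "\<dots> = (\<Sum>A\<in>?M. if A \<in> dual_set s n G P then Const (of_nat (card P)) * ?m A else 0)"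
    by (intro sum.cong refl) (simp add: sum_pairing_subgroup[OF G.is_group assms(6)] Const_zero)
  also have "\<dots> = (\<Sum>A\<in>?M \<inter> dual_set s n G P. Const (of_nat (card P)) * ?m A)"
    using finM by (rule sum.inter_restrict[symmetric])
  also have "?M \<inter> dual_set s n G P = dual_set s n G P"
    by (auto simp: dual_set_def)
  also have "(\<Sum>A\<in>dual_set s n G P. Const (of_nat (card P)) * ?m A) =
      Const (of_nat (card P)) * weight_enumerator s n G (dual_set s n G P)"
    by (simp add: weight_enumerator_def sum_distrib_left)
  finally show ?thesis
    by (simp only: mult.assoc[symmetric] cancel mult_1_left)
qed

end
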